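(* Let $J^c_n=T^c_n+T^c_n$ be the disjoint union of two copies of $T^c_n$. For each $\epsilon>0$, for $n$ and $c$ sufficiently large, we have $$\frac{|L(J^c_n)|}{|V(J^c_n)|}\leq\epsilon\quad\text{and}\quad\frac{s^L_2(J^c_n)}{|V(J^c_n)|}\geq 1-\epsilon.$$
   Context: **Game.** A position is a finite directed graph $G=(L\cup R,A)$ whose vertex set $V(G)=L\cup R$ is partitioned into $L=L(G)$ and $R=R(G)$. For $S\subseteq V(G)$, $G\setminus S$ is the subgraph induced on $V(G)\setminus S$. $\mathrm{Succ}(G,x)$ (resp. $\mathrm{Pred}(G,x)$) is the set of vertices reachable from $x$ (resp. that can reach $x$) by a directed path, including $x$. Left and Right alternate; Left chooses $x\in L$ and removes $\mathrm{Succ}(G,x)$, Right chooses $y\in R$ and removes $\mathrm{Pred}(G,y)$; a player's score is the number of vertices he removed. **Relevant graphs.** $\mathrm{Forc}(G)=\{x\in L:\mathrm{Succ}(G,x)\subseteq L\}\cup\{y\in R:\mathrm{Pred}(G,y)\subseteq R\}$; $G$ is relevant if $\mathrm{Forc}(G)=\emptyset$, and $\mathcal{S}$ is the class of relevant graphs. On relevant graphs, forced vertices created by a move are immediately given to the player who moved: for $x\in L$, $\mathrm{Rmv}(G,x)=\mathrm{Succ}(G,x)\cup\mathrm{Forc}(G\setminus\mathrm{Succ}(G,x))$; for $y\in R$, $\mathrm{Rmv}(G,y)=\mathrm{Pred}(G,y)\cup\mathrm{Forc}(G\setminus\mathrm{Pred}(G,y))$; and $G_u=G\setminus\mathrm{Rmv}(G,u)$,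 again in $\mathcal{S}$. **Scores.** $s^L_1(G)$ (resp. $s^L_2(G)$) is Left's optimal score when Left (resp. Right) starts. Both are $0$ on the empty graph and, for nonempty $G\in\mathcal{S}$, $s^L_1(G)=\max_{x\in L}\{|\mathrm{Rmv}(G,x)|+s^L_2(G_x)\}$, $s^L_2(G)=\min_{y\in R}s^L_1(G_y)$. **Trees.** For integers $n\ge 0$, $c\ge 1$, $T^c_n$ is the rooted tree of depth $n+1$ with arcs oriented from parent to child (away from the root, which is at level $0$), in which every vertex of level $k$, $0\le k\le n-1$, has exactly $3$ children and every vertex of level $n$ has exactly $c$ children. $R$ is the set of leaves (level $n+1$) and $L$ is the set of all other vertices (levels $0,\dots,n$). These graphs are relevant. *)

theory Defs
  imports Complex_Main
begin

section \<open>Positions\<close>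

record 'a position =
  lefts :: "'a set"
  rights :: "'a set"
  arcs :: "('a \<times> 'a) set"

definition verts :: "'a position \<Rightarrow> 'a set" where
  "verts G = lefts G \<union> rights G"

definition is_position :: "'a position \<Rightarrow> bool" where
  "is_position G \<longleftrightarrow>
     finite (verts G) \<and> lefts G \<inter> rights G = {} \<and> arcs G \<subseteq> verts G \<times> verts G"

definition delete :: "'a position \<Rightarrow> 'a set \<Rightarrow> 'a position" where
  "delete G S =
     \<lparr>lefts = lefts G - S, rights = rights G - S, arcs = arcs G \<inter> (- S) \<times> (- S)\<rparr>"

definition Succ :: "'a position \<Rightarrow> 'a \<Rightarrow> 'a set" where
  "Succ G x = {y. (x, y) \<in> (arcs G)\<^sup>*}"

definition Pred :: "'a position \<Rightarrow> 'a \<Rightarrow> 'a set" where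
  "Pred G x = {y. (y, x) \<in> (arcs G)\<^sup>*}"

definition Forc :: "'a position \<Rightarrow> 'a set" where
  "Forc G = {x \<in> lefts G. Succ G x \<subseteq> lefts G} \<union> {y \<in> rights G. Pred G y \<subseteq> rights G}"

definition relevant :: "'a position \<Rightarrow> bool" where
  "relevant G \<longleftrightarrow> Forc G = {}"

definition RmvL :: "'a position \<Rightarrow> 'a \<Rightarrow> 'a set" where
  "RmvL G x = Succ G x \<union> Forc (delete G (Succ G x))"

definition RmvR :: "'a position \<Rightarrow> 'a \<Rightarrow> 'a set" where
  "RmvR G y = Pred G y \<union> Forc (delete G (Pred G y))"

definition Rmv :: "'a position \<Rightarrow> 'a \<Rightarrow> 'a set" where
  "Rmv G u = (if u \<in> lefts G then RmvL G u else RmvR G u)"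

definition after :: "'a position \<Rightarrow> 'a \<Rightarrow> 'a position" where
  "after G u = delete G (Rmv G u)"


section \<open>Optimal scores\<close>

lemma verts_delete [simp]: "verts (delete G S) = verts G - S"
  by (auto simp: verts_def delete_def)

lemma self_in_Rmv: "u \<in> Rmv G u"
  by (simp add: Rmv_def RmvL_def RmvR_def Succ_def Pred_def)

lemma card_verts_after:
  assumes "finite (verts G)" "u \<in> verts G"
  shows "card (verts (after G u)) < card (verts G)"
  unfolding after_def verts_delete
  using assms self_in_Rmv[of u G] by (intro psubset_card_mono) auto

lemma in_verts: "u \<in> lefts G \<Longrightarrow> u \<in> verts G" "u \<in> rights G \<Longrightarrow> u \<in> verts G"
  by (simp_all add: verts_def)

text \<open>The recursion is meant for relevant positions, a class closed under moves (lemma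
  \<open>relevant_after\<close> below), where both players have a move as long as the position is
  nonempty (lemma \<open>relevant_nonempty\<close>). Values at other arguments are irrelevant.\<close>

function sL1 :: "'a position \<Rightarrow> nat" and sL2 :: "'a position \<Rightarrow> nat" where
  "sL1 G = (if finite (verts G) \<and> verts G \<noteq> {}
            then Max ((\<lambda>x. card (Rmv G x) + sL2 (after G x)) ` lefts G) else 0)"
| "sL2 G = (if finite (verts G) \<and> verts G \<noteq> {}
            then Min ((\<lambda>y. sL1 (after G y)) ` rights G) else 0)"
  by pat_completeness auto
termination
  by (relation "measure (case_sum (\<lambda>G. card (verts G)) (\<lambda>G. card (verts G)))")
     (auto intro!: card_verts_after simp: in_verts)

declare sL1.simps [simp del] sL2.simps [simp del]


section \<open>Relevant positions are closed under moves\<close>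

lemma Forc_subset: "Forc G \<subseteq> verts G"
  by (auto simp: Forc_def verts_def)

lemma is_position_delete: "is_position G \<Longrightarrow> is_position (delete G S)"
  by (auto simp: is_position_def verts_def delete_def)

lemma reach_in_verts:
  assumes "is_position G" "(u, v) \<in> (arcs G)\<^sup>*" "u \<in> verts G \<or> v \<in> verts G"
  shows "u \<in> verts G \<and> v \<in> verts G"
  using assms(2,3) by (induction rule: rtrancl_induct)
    (use assms(1) in \<open>auto simp: is_position_def\<close>)

lemma relevant_nonempty:
  assumes "is_position G" "relevant G" "verts G \<noteq> {}"
  shows "lefts G \<noteq> {}" "rights G \<noteq> {}"
proof -
  have "lefts G \<noteq> {} \<and> rights G \<noteq> {}"
    using assms reach_in_verts[OF assms(1)]
    by (auto simp: relevant_def Forc_def Succ_def Pred_def verts_def) blast+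
  thus "lefts G \<noteq> {}" "rights G \<noteq> {}" by auto
qed

lemma reach_delete:
  assumes "(u, v) \<in> (arcs G)\<^sup>*"
    and "\<And>w. (u, w) \<in> (arcs G)\<^sup>* \<Longrightarrow> (w, v) \<in> (arcs G)\<^sup>* \<Longrightarrow> w \<notin> S"
  shows "(u, v) \<in> (arcs (delete G S))\<^sup>*"
  using assms
proof (induction rule: converse_rtrancl_induct)
  case (step y z)
  have "(y, z) \<in> arcs (delete G S)"
    using step.hyps step.prems[of y] step.prems[of z]
    by (auto simp: delete_def intro: converse_rtrancl_into_rtrancl)
  moreover have "(z, v) \<in> (arcs (delete G S))\<^sup>*"
    using step.IH step.prems converse_rtrancl_into_rtrancl[OF step.hyps(1)] by blast
  ultimately show ?case by (rule converse_rtrancl_into_rtrancl)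
qed simp

lemma reach_delete_sub: "(u, v) \<in> (arcs (delete G S))\<^sup>* \<Longrightarrow> (u, v) \<in> (arcs G)\<^sup>*"
  using rtrancl_mono[of "arcs (delete G S)" "arcs G"] by (auto simp: delete_def)

lemma relevant_after_left:
  assumes pos: "is_position G" and rel: "relevant G"
  shows "relevant (delete G (RmvL G x))"
proof -
  define H where "H = delete G (Succ G x)"
  define K where "K = delete G (RmvL G x)"
  have posH: "is_position H" and posK: "is_position K"
    unfolding H_def K_def using pos by (auto intro: is_position_delete)
  have disj: "lefts G \<inter> rights G = {}" using pos by (simp add: is_position_def)
  have above: "\<exists>z\<in>lefts G. (z, y) \<in> (arcs G)\<^sup>*" if "y \<in> rights G" for y
  proof -
    have "\<not> Pred G y \<subseteq> rights G" using rel that by (auto simp: relevant_def Forc_def)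
    then obtain z where "(z, y) \<in> (arcs G)\<^sup>*" "z \<notin> rights G" by (auto simp: Pred_def)
    thus ?thesis using reach_in_verts[OF pos, of z y] that by (auto simp: verts_def)
  qed
  have reachH: "(u, v) \<in> (arcs H)\<^sup>*" if "(u, v) \<in> (arcs G)\<^sup>*" "v \<notin> Succ G x" for u v
    unfolding H_def
    by (rule reach_delete[OF that(1)]) (use that(2) in \<open>auto simp: Succ_def intro: rtrancl_trans\<close>)
  have lrH: "lefts H = lefts G - Succ G x" "rights H = rights G - Succ G x"
    by (simp_all add: H_def delete_def)
  have RmvH: "RmvL G x = Succ G x \<union> Forc H" by (simp add: RmvL_def H_def)
  have noR: "w \<notin> Forc H" if w: "w \<in> rights G" for w
  proof
    assume F: "w \<in> Forc H"
    hence nS: "w \<notin> Succ G x" using Forc_subset[of H] by (auto simp: H_def)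
    from above[OF w] obtain z where z: "z \<in> lefts G" "(z, w) \<in> (arcs G)\<^sup>*" by auto
    have "z \<in> Pred H w" using reachH[OF z(2) nS] by (simp add: Pred_def)
    thus False using F z(1) w disj by (auto simp: Forc_def lrH)
  qed
  have reachK: "(u, v) \<in> (arcs K)\<^sup>*"
    if uv: "(u, v) \<in> (arcs G)\<^sup>*" and v: "v \<in> rights G" "v \<notin> RmvL G x" for u v
    unfolding K_def
  proof (rule reach_delete[OF uv])
    fix w assume w: "(w, v) \<in> (arcs G)\<^sup>*"
    have nS: "v \<notin> Succ G x" using v by (simp add: RmvL_def)
    have "w \<notin> Succ G x" using w nS by (auto simp: Succ_def intro: rtrancl_trans)
    moreover have "w \<notin> Forc H"
    proof
      assume F: "w \<in> Forc H"
      have "v \<in> Succ H w" using reachH[OF w nS] by (simp add: Succ_def)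
      thus False using F noR[of w] v(1) disj by (auto simp: Forc_def lrH)
    qed
    ultimately show "w \<notin> RmvL G x" by (simp add: RmvL_def H_def)
  qed
  have lrK: "lefts K = lefts G - RmvL G x" "rights K = rights G - RmvL G x"
    by (simp_all add: K_def delete_def)
  have "\<not> Pred K y \<subseteq> rights K" if y: "y \<in> rights K" for y
  proof -
    from y above obtain z where "z \<in> lefts G" "(z, y) \<in> (arcs G)\<^sup>*" by (auto simp: lrK)
    moreover from this have "z \<in> Pred K y" using reachK y by (auto simp: Pred_def lrK)
    ultimately show ?thesis using disj by (auto simp: lrK)
  qed
  moreover have "\<not> Succ K u \<subseteq> lefts K" if u: "u \<in> lefts K" for u
  proof -
    have uH: "u \<in> lefts H" "u \<notin> Forc H" using u by (auto simp: lrK lrH RmvH)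
    then obtain v where v: "(u, v) \<in> (arcs H)\<^sup>*" "v \<notin> lefts H"
      by (auto simp: Forc_def Succ_def)
    have "v \<in> rights H" using reach_in_verts[OF posH v(1)] uH(1) v(2) by (auto simp: verts_def)
    hence vG: "v \<in> rights G" "v \<notin> RmvL G x"
      using noR[of v] by (auto simp: lrH RmvH)
    have "v \<in> Succ K u"
      using reachK[OF _ vG] v(1) reach_delete_sub[of u v G] by (auto simp: H_def Succ_def)
    thus ?thesis using vG(1) disj by (auto simp: lrK)
  qed
  ultimately show ?thesis by (auto simp: relevant_def Forc_def K_def)
qed

definition mirror :: "'a position \<Rightarrow> 'a position" where
  "mirror G = \<lparr>lefts = rights G, rights = lefts G, arcs = (arcs G)\<inverse>\<rparr>"

lemma mirror_simps:
  "is_position (mirror G) = is_position G"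
  "Succ (mirror G) x = Pred G x"
  "Pred (mirror G) x = Succ G x"
  "Forc (mirror G) = Forc G"
  "relevant (mirror G) = relevant G"
  "delete (mirror G) S = mirror (delete G S)"
  "RmvL (mirror G) x = RmvR G x"
proof -
  show pos: "is_position (mirror G) = is_position G"
    by (auto simp: mirror_def is_position_def verts_def)
  show SP: "Succ (mirror G) x = Pred G x" "Pred (mirror G) x = Succ G x" for G :: "'a position" and x
    by (simp_all add: mirror_def Succ_def Pred_def rtrancl_converse)
  have F: "Forc (mirror G) = Forc G" for G :: "'a position"
    unfolding Forc_def SP by (auto simp: mirror_def)
  thus "Forc (mirror G) = Forc G" .
  show "relevant (mirror G) = relevant G" by (simp add: relevant_def F)
  have D: "delete (mirror G) S = mirror (delete G S)" for S
    by (auto simp: mirror_def delete_def)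
  thus "delete (mirror G) S = mirror (delete G S)" .
  show "RmvL (mirror G) x = RmvR G x" by (simp add: RmvL_def RmvR_def SP F D)
qed

theorem relevant_after:
  assumes "is_position G" "relevant G"
  shows "is_position (after G u)" "relevant (after G u)"
proof -
  show "is_position (after G u)" using assms(1) by (simp add: after_def is_position_delete)
  have "relevant (delete G (RmvR G u))"
    using relevant_after_left[of "mirror G" u] assms by (simp add: mirror_simps)
  thus "relevant (after G u)"
    using relevant_after_left[OF assms, of u] by (simp add: after_def Rmv_def)
qed


section \<open>Trees\<close>

text \<open>A vertex is the list of child indices along the path from the root, so that its level
  is its length.\<close>

definition tree :: "nat \<Rightarrow> nat \<Rightarrow> nat list position" where
  "tree c n =
     \<lparr>lefts = {p. length p \<le> n \<and> set p \<subseteq> {..<3}},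
      rights = {p @ [i] |p i. length p = n \<and> set p \<subseteq> {..<3} \<and> i < c},
      arcs = {(p, p @ [i]) |p i. length p < n \<and> set p \<subseteq> {..<3} \<and> i < 3} \<union>
             {(p, p @ [i]) |p i. length p = n \<and> set p \<subseteq> {..<3} \<and> i < c}\<rparr>"

definition disjoint_union :: "'a position \<Rightarrow> 'b position \<Rightarrow> ('a + 'b) position" where
  "disjoint_union G H =
     \<lparr>lefts = lefts G <+> lefts H,
      rights = rights G <+> rights H,
      arcs = map_prod Inl Inl ` arcs G \<union> map_prod Inr Inr ` arcs H\<rparr>"

definition J :: "nat \<Rightarrow> nat \<Rightarrow> (nat list + nat list) position" where
  "J c n = disjoint_union (tree c n) (tree c n)"

lemma is_position_tree: "is_position (tree c n)"
proof -
  have fin: "finite {p :: nat list. length p \<le> n \<and> set p \<subseteq> {..<3}}"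
    using finite_lists_length_le[of "{..<3::nat}" n] by (simp add: conj_commute)
  have "rights (tree c n) \<subseteq> (\<lambda>(p, i). p @ [i]) ` ({p. length p \<le> n \<and> set p \<subseteq> {..<3}} \<times> {..<c})"
    by (auto simp: tree_def image_iff)
  hence "finite (rights (tree c n))"
    by (rule finite_subset) (intro finite_imageI finite_cartesian_product fin, simp)
  thus ?thesis using fin by (auto simp: is_position_def verts_def tree_def)
qed

lemma tree_root_reach:
  assumes "p \<in> verts (tree c n)"
  shows "([], p) \<in> (arcs (tree c n))\<^sup>*"
  using assms
proof (induction p rule: rev_induct)
  case (snoc i p)
  hence "p \<in> verts (tree c n)" "(p, p @ [i]) \<in> arcs (tree c n)"
    by (auto simp: verts_def tree_def)
  thus ?case using snoc.IH by (meson rtrancl_into_rtrancl)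
qed simp

lemma tree_leaf_reach:
  assumes "p \<in> lefts (tree c n)" "c \<ge> 1"
  shows "\<exists>q \<in> rights (tree c n). (p, q) \<in> (arcs (tree c n))\<^sup>*"
  using assms(1)
proof (induction "n - length p" arbitrary: p)
  case 0
  hence "p @ [0] \<in> rights (tree c n)" "(p, p @ [0]) \<in> arcs (tree c n)"
    using assms(2) by (auto simp: tree_def)
  thus ?case by blast
next
  case (Suc k)
  have "p @ [0] \<in> lefts (tree c n)" "(p, p @ [0]) \<in> arcs (tree c n)" "k = n - length (p @ [0])"
    using Suc.hyps(2) Suc.prems by (auto simp: tree_def)
  moreover from this obtain q where
    "q \<in> rights (tree c n)" "(p @ [0], q) \<in> (arcs (tree c n))\<^sup>*"
    using Suc.hyps(1)[of "p @ [0]"] by blast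
  ultimately show ?case by (meson converse_rtrancl_into_rtrancl)
qed

lemma relevant_tree:
  assumes "c \<ge> 1"
  shows "relevant (tree c n)"
proof -
  have disj: "lefts (tree c n) \<inter> rights (tree c n) = {}"
    using is_position_tree by (auto simp: is_position_def)
  have "\<not> Succ (tree c n) p \<subseteq> lefts (tree c n)" if "p \<in> lefts (tree c n)" for p
    using tree_leaf_reach[OF that assms] disj by (auto simp: Succ_def)
  moreover have "\<not> Pred (tree c n) p \<subseteq> rights (tree c n)" if "p \<in> rights (tree c n)" for p
    using tree_root_reach[of p c n] that by (auto simp: Pred_def verts_def tree_def)
  ultimately show ?thesis by (auto simp: relevant_def Forc_def)
qed

lemma is_position_J: "is_position (J c n)"
  using is_position_tree[of c n]
  by (fastforce simp: J_def disjoint_union_def is_position_def verts_def)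

lemma relevant_J:
  assumes "c \<ge> 1"
  shows "relevant (J c n)"
proof -
  let ?T = "tree c n"
  have step: "(Inl p, Inl q) \<in> arcs (J c n)" "(Inr p, Inr q) \<in> arcs (J c n)"
    if "(p, q) \<in> arcs ?T" for p q
    using that by (force simp: J_def disjoint_union_def)+
  have lift: "(Inl p, Inl q) \<in> (arcs (J c n))\<^sup>* \<and> (Inr p, Inr q) \<in> (arcs (J c n))\<^sup>*"
    if "(p, q) \<in> (arcs ?T)\<^sup>*" for p q
    using that by induction (auto intro: step rtrancl_into_rtrancl)
  have disj: "lefts (J c n) \<inter> rights (J c n) = {}"
    using is_position_J by (auto simp: is_position_def)
  have lr: "lefts (J c n) = lefts ?T <+> lefts ?T" "rights (J c n) = rights ?T <+> rights ?T"
    by (simp_all add: J_def disjoint_union_def)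
  have "\<exists>v \<in> rights (J c n). v \<in> Succ (J c n) u" if "u \<in> lefts (J c n)" for u
    using that tree_leaf_reach[OF _ assms] lift unfolding lr Succ_def
    by (elim PlusE) (blast intro: InlI InrI)+
  moreover have "\<exists>v \<in> lefts (J c n). v \<in> Pred (J c n) u" if "u \<in> rights (J c n)" for u
  proof -
    have "[] \<in> lefts ?T" by (simp add: tree_def)
    thus ?thesis using that tree_root_reach[of _ c n] in_verts(2)[of _ ?T] lift
      unfolding lr Pred_def by (elim PlusE) (blast intro: InlI InrI)+
  qed
  ultimately show ?thesis using disj by (auto simp: relevant_def Forc_def)
qed

end

theory Submission
  imports Defs "HOL-Real_Asymp.Real_Asymp"
begin

text \<open>Left always takes a whole component that is a tree of maximal height. Give a component
  $T^c_k$ the potential $2^k$. A move of Right in $T^c_j$ turns it into two copies of each of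
  $T^c_0, \dots, T^c_{j-1}$, so the potential grows by $2^j - 2$; if Left has just removed a
  component of height $l \ge j$, it drops by at least $2$ over both moves. As $J^c_n$ has
  potential $2 \cdot 2^n$, Right makes only $O(2^n)$ moves, each worth at most $n + 1 + c$
  vertices, which is negligible against the $2c \cdot 3^n$ leaves.\<close>

section \<open>Weights on heights and their sums\<close>

text \<open>Vertex weights that add up to $2^k$ over the internal vertices of $T^c_k$, where a vertex
  weighs \<open>wt\<close> of its height, so that $wt(k) = 2^k - 3 \cdot 2^{k-1}$ for $k \ge 1$. The potential is
  thereby a sum over vertices, and no decomposition into components is needed.\<close>

definition wt :: "nat \<Rightarrow> int" where
  "wt k = (if k = 0 then 1 else - (2 ^ (k - 1)))"

lemma sum_wt_atMost: "(\<Sum>k\<le>l. wt k) = 2 - 2 ^ l"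
  by (induction l) (auto simp: wt_def)

text \<open>Only \<open>wt 0\<close> is positive, so among sets of heights containing 0 the complete
  chain \<open>{..l}\<close> weighs least. Applied to the path that Right removes, this bounds the
  growth of the potential by \<open>2 ^ l - 2\<close>.\<close>

lemma sum_wt_ge:
  assumes "S \<subseteq> {..l}" "0 \<in> S"
  shows "2 - 2 ^ l \<le> sum wt S"
proof -
  have "sum wt {..l} = sum wt S + sum wt ({..l} - S)"
    using sum.subset_diff[OF assms(1), of wt] by simp
  moreover have "sum wt ({..l} - S) \<le> 0"
    using assms(2) by (intro sum_nonpos) (auto simp: wt_def intro: gr0I)
  ultimately show ?thesis by (simp add: sum_wt_atMost)
qed

text \<open>The lists are the addresses of internal vertices relative to a vertex of height
  \<open>l\<close>. Splitting off the root leaves three child subtrees, chosen by the head of the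
  list: \<open>- (2 ^ l) + 3 * 2 ^ l = 2 ^ Suc l\<close>.\<close>

lemma sum_wt_ternary_lists:
  "(\<Sum>q | set q \<subseteq> {..<3::nat} \<and> length q \<le> l. wt (l - length q)) = 2 ^ l"
proof (induction l)
  case 0
  have "{q. set q \<subseteq> {..<3::nat} \<and> length q \<le> 0} = {[]}" by auto
  thus ?case by (simp add: wt_def)
next
  case (Suc l)
  let ?A = "\<lambda>l. {q. set q \<subseteq> {..<3::nat} \<and> length q \<le> l}"
  have fin: "finite (?A l)" for l by (rule finite_lists_length_le) simp
  have eq: "?A (Suc l) = insert [] ((\<lambda>(i, q). i # q) ` ({..<3} \<times> ?A l))" (is "_ = insert _ (?f ` _)")
  proof (intro set_eqI)
    fix q show "q \<in> ?A (Suc l) \<longleftrightarrow> q \<in> insert [] (?f ` ({..<3} \<times> ?A l))"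
      by (cases q) auto
  qed
  have inj: "inj_on ?f ({..<3} \<times> ?A l)" by (auto simp: inj_on_def)
  have "(\<Sum>q\<in>?A (Suc l). wt (Suc l - length q))
      = wt (Suc l) + (\<Sum>q\<in>?f ` ({..<3} \<times> ?A l). wt (Suc l - length q))"
    unfolding eq using fin by (subst sum.insert) auto
  also have "(\<Sum>q\<in>?f ` ({..<3} \<times> ?A l). wt (Suc l - length q))
      = (\<Sum>(i, q)\<in>{..<3::nat} \<times> ?A l. wt (l - length q))"
    by (subst sum.reindex[OF inj]) (auto intro!: sum.cong)
  also have "\<dots> = 3 * 2 ^ l"
    by (subst sum.cartesian_product[symmetric]) (simp add: Suc)
  finally show ?case by (simp add: wt_def)
qed

section \<open>Forests with heights and their induced positions\<close>

text \<open>The axioms speak of reachability and therefore pass componentwise to disjoint unions.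
  \<open>chain\<close> makes the ancestors of a vertex linearly ordered, heights are counted from
  the parents of leaves, and the branching number 3 enters only through
  \<open>subtree\<close>.\<close>

locale ternary_forest =
  fixes G :: "'a position" and h :: "'a \<Rightarrow> nat" and par :: "'a \<Rightarrow> 'a" and n c :: nat
  assumes pos: "is_position G"
    and rel: "relevant G"
    and leaf: "y \<in> rights G \<Longrightarrow> Succ G y = {y}"
    and chain: "(u, w) \<in> (arcs G)\<^sup>* \<Longrightarrow> (v, w) \<in> (arcs G)\<^sup>* \<Longrightarrow>
                  (u, v) \<in> (arcs G)\<^sup>* \<or> (v, u) \<in> (arcs G)\<^sup>*"
    and height_less: "u \<in> lefts G \<Longrightarrow> v \<in> lefts G \<Longrightarrow> (u, v) \<in> (arcs G)\<^sup>* \<Longrightarrow> u \<noteq> v \<Longrightarrow> h v < h u"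
    and height_le: "u \<in> lefts G \<Longrightarrow> h u \<le> n"
    and par: "y \<in> rights G \<Longrightarrow> par y \<in> lefts G \<and> h (par y) = 0"
    and Pred_par: "y \<in> rights G \<Longrightarrow> Pred G y = insert y (Pred G (par y))"
    and card_siblings: "card {y \<in> rights G. par y = q} \<le> c"
    and subtree: "x \<in> lefts G \<Longrightarrow> (\<Sum>v\<in>Succ G x \<inter> lefts G. wt (h v)) = 2 ^ h x"
begin

text \<open>The vertex sets of the positions that arise when Left only takes whole components:
  closed under descendants and leaving no leaf without its parent.\<close>

definition full :: "'a set \<Rightarrow> bool" where
  "full W \<longleftrightarrow> W \<subseteq> verts G \<and> (\<forall>x\<in>W. Succ G x \<subseteq> W) \<and>
     (\<forall>y\<in>W \<inter> rights G. Pred G y \<inter> W \<inter> lefts G \<noteq> {})"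

text \<open>Positions of the play are encoded by vertex sets inside the fixed \<open>G\<close>, so
  that heights, parents and reachability can always be taken in \<open>G\<close>.\<close>

definition induced :: "'a set \<Rightarrow> 'a position" where
  "induced W = delete G (- W)"

definition pot :: "'a set \<Rightarrow> int" where
  "pot W = (\<Sum>v\<in>W \<inter> lefts G. wt (h v))"

lemma finite_verts: "finite (verts G)"
  using pos by (simp add: is_position_def)

lemma disj: "lefts G \<inter> rights G = {}"
  using pos by (simp add: is_position_def)

lemma verts_G: "verts G = lefts G \<union> rights G"
  by (simp add: verts_def)

lemma induced_simps:
  "lefts (induced W) = lefts G \<inter> W" "rights (induced W) = rights G \<inter> W"
  "verts (induced W) = verts G \<inter> W" "delete (induced W) S = induced (W - S)"
  by (auto simp: induced_def delete_def verts_def)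

text \<open>Closure under descendants is assumed instead of \<open>full W\<close> because the
  results built on this are also needed right after Right removes \<open>Pred G y\<close>, when some
  leaves may have lost their parent.\<close>

lemma Succ_induced:
  assumes "\<And>v. v \<in> W \<Longrightarrow> Succ G v \<subseteq> W" "x \<in> W"
  shows "Succ (induced W) x = Succ G x"
  using assms by (auto simp: Succ_def induced_def intro!: reach_delete dest: reach_delete_sub)

lemma Pred_induced:
  assumes "\<And>v. v \<in> W \<Longrightarrow> Succ G v \<subseteq> W" "W \<subseteq> verts G" "y \<in> W"
  shows "Pred (induced W) y = Pred G y \<inter> W"
proof (intro equalityI subsetI)
  fix z assume z: "z \<in> Pred (induced W) y"
  hence "(z, y) \<in> (arcs G)\<^sup>*" by (auto simp: Pred_def induced_def dest: reach_delete_sub)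
  moreover have "z \<in> W"
    using reach_in_verts[of "induced W" z y] z is_position_delete[OF pos] assms(2,3)
    by (auto simp: Pred_def induced_simps) (auto simp: induced_def)
  ultimately show "z \<in> Pred G y \<inter> W" by (simp add: Pred_def)
next
  fix z assume "z \<in> Pred G y \<inter> W"
  thus "z \<in> Pred (induced W) y"
    using Succ_induced[OF assms(1), of z] by (auto simp: Pred_def Succ_def)
qed

lemma reaches_right:
  assumes "x \<in> lefts G"
  shows "Succ G x \<inter> rights G \<noteq> {}"
proof -
  from rel assms obtain v where "v \<in> Succ G x" "v \<notin> lefts G"
    by (auto simp: relevant_def Forc_def)
  thus ?thesis using reach_in_verts[OF pos, of x v] assms by (auto simp: Succ_def verts_def)
qed

text \<open>A surviving internal vertex keeps all its descendants, among them a leaf, and so is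
  never forced. Only leaves cut off from every internal ancestor can be.\<close>

lemma Forc_induced:
  assumes "\<And>v. v \<in> W \<Longrightarrow> Succ G v \<subseteq> W" "W \<subseteq> verts G"
  shows "Forc (induced W) = {y \<in> rights G \<inter> W. Pred G y \<inter> W \<inter> lefts G = {}}"
proof -
  have "\<not> Succ (induced W) x \<subseteq> lefts G \<inter> W" if "x \<in> lefts G \<inter> W" for x
    using that reaches_right[of x] disj Succ_induced[OF assms(1), of x] by blast
  moreover have "Pred (induced W) y \<subseteq> rights G \<inter> W \<longleftrightarrow> Pred G y \<inter> W \<inter> lefts G = {}"
    if "y \<in> rights G \<inter> W" for y
    using that Pred_induced[OF assms, of y] assms(2) disj verts_G by blast
  ultimately show ?thesis unfolding Forc_def induced_simps by blast
qed

lemma leaf_reach: "y \<in> rights G \<Longrightarrow> (y, z) \<in> (arcs G)\<^sup>* \<Longrightarrow> z = y"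
  using leaf[of y] by (auto simp: Succ_def)

lemma full_Succ: "full W \<Longrightarrow> v \<in> W \<Longrightarrow> Succ G v \<subseteq> W"
  by (simp add: full_def)

lemma full_subset: "full W \<Longrightarrow> W \<subseteq> verts G"
  by (simp add: full_def)

lemma Forc_full: "full W \<Longrightarrow> Forc (induced W) = {}"
  using Forc_induced[of W] by (auto simp: full_def)

lemma full_nonempty:
  assumes "full W" "W \<noteq> {}"
  shows "W \<inter> lefts G \<noteq> {}" "W \<inter> rights G \<noteq> {}"
proof -
  from assms show 1: "W \<inter> lefts G \<noteq> {}"
    unfolding full_def verts_G by blast
  then obtain x where "x \<in> W" "x \<in> lefts G" by blast
  thus "W \<inter> rights G \<noteq> {}" using reaches_right[of x] full_Succ[OF assms(1), of x] by blast
qed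

section \<open>The effect of one move of each player\<close>

text \<open>A vertex of maximal height is the root of its component: by \<open>chain\<close>, a
  vertex outside \<open>Succ G x\<close> sharing a descendant with \<open>x\<close> would be a
  proper ancestor of \<open>x\<close>, hence higher. Removing the whole component cuts off no leaf,
  so nothing is forced.\<close>

lemma Rmv_left:
  assumes W: "full W" and x: "x \<in> W \<inter> lefts G"
    and top: "\<And>v. v \<in> W \<inter> lefts G \<Longrightarrow> h v \<le> h x"
  shows "full (W - Succ G x)" "Rmv (induced W) x = Succ G x"
    "after (induced W) x = induced (W - Succ G x)"
proof -
  have "Succ G v \<inter> Succ G x = {}" if v: "v \<in> W - Succ G x" for v
  proof (rule ccontr)
    assume "Succ G v \<inter> Succ G x \<noteq> {}"
    then obtain w where "(v, w) \<in> (arcs G)\<^sup>*" "(x, w) \<in> (arcs G)\<^sup>*" by (auto simp: Succ_def)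
    hence vx: "(v, x) \<in> (arcs G)\<^sup>*" using chain v by (auto simp: Succ_def)
    have ne: "v \<noteq> x" using v by (auto simp: Succ_def)
    have "v \<in> lefts G"
      using leaf_reach[of v x] vx ne v full_subset[OF W] by (auto simp: verts_def)
    thus False using height_less[of v x] vx ne top[of v] x v by auto
  qed
  \<comment> \<open>Ancestors of a surviving leaf survive, which preserves the last condition in
    \<open>full\<close>.\<close>
  moreover have "z \<in> Pred G y \<Longrightarrow> y \<notin> Succ G x \<Longrightarrow> z \<notin> Succ G x" for y z
    by (auto simp: Pred_def Succ_def intro: rtrancl_trans)
  ultimately show full: "full (W - Succ G x)"
    using W unfolding full_def by blast
  have S: "Succ (induced W) x = Succ G x"
    using Succ_induced[OF full_Succ[OF W]] x by blast
  show R: "Rmv (induced W) x = Succ G x"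
    using x Forc_full[OF full] by (simp add: Rmv_def RmvL_def S induced_simps)
  show "after (induced W) x = induced (W - Succ G x)"
    by (simp add: after_def R induced_simps)
qed

text \<open>The ancestors of \<open>y\<close> form a chain along which heights strictly decrease.
  Both the size and the weight of a removed path can thus be read off from its set of
  heights.\<close>

lemma inj_on_height_Pred:
  assumes "C \<subseteq> Pred G y \<inter> lefts G"
  shows "inj_on h C"
proof (rule inj_onI, rule ccontr)
  fix u v assume "u \<in> C" "v \<in> C" "h u = h v" "u \<noteq> v"
  thus False using assms chain[of u y v] height_less[of u v] height_less[of v u]
    by (auto simp: Pred_def subset_iff)
qed

text \<open>Right takes the path down to \<open>y\<close> together with leaves that lose their
  parent, all of them siblings of \<open>y\<close>. The path has at most one internal vertex per
  height and contains the height 0, so \<open>sum_wt_ge\<close> controls the potential.\<close>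

lemma after_right:
  assumes W: "full W" and y: "y \<in> W \<inter> rights G"
    and le: "\<And>v. v \<in> W \<inter> lefts G \<Longrightarrow> h v \<le> l"
  obtains W' where "after (induced W) y = induced W'" "full W'" "W' \<subset> W"
    "card W \<le> card W' + (n + 1 + c)" "pot W' + 2 \<le> pot W + 2 ^ l"
proof -
  define W1 where "W1 = W - Pred G y"
  define F where "F = {f \<in> rights G \<inter> W1. Pred G f \<inter> W1 \<inter> lefts G = {}}"
  define W' where "W' = W1 - F"
  have W1: "Succ G v \<subseteq> W1" if "v \<in> W1" for v
    using that full_Succ[OF W, of v]
    by (auto simp: W1_def Pred_def Succ_def intro: rtrancl_trans)
  have W1_sub: "W1 \<subseteq> verts G" using full_subset[OF W] by (auto simp: W1_def)
  have Fo: "Forc (induced W1) = F"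
    unfolding F_def using W1 W1_sub by (rule Forc_induced)
  have P: "Pred (induced W) y = Pred G y \<inter> W"
    using Pred_induced[OF full_Succ[OF W] full_subset[OF W]] y by blast
  have "delete (induced W) (Pred G y \<inter> W) = induced W1"
    by (simp add: induced_simps W1_def Diff_Int)
  hence R: "Rmv (induced W) y = (Pred G y \<inter> W) \<union> F"
    using y disj by (auto simp: Rmv_def RmvR_def P Fo induced_simps)
  have fullW': "full W'"
    unfolding full_def
  proof (intro conjI ballI)
    show "W' \<subseteq> verts G" using W1_sub by (auto simp: W'_def)
  next
    fix v assume v: "v \<in> W'"
    have "f \<notin> F" if "f \<in> Succ G v" for f
    proof (cases "v \<in> lefts G")
      case True
      thus ?thesis using that v by (auto simp: F_def W'_def Pred_def Succ_def)
    next
      case False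
      hence "f = v" using leaf[of v] v W1_sub that by (auto simp: W'_def verts_G)
      thus ?thesis using v by (simp add: W'_def)
    qed
    thus "Succ G v \<subseteq> W'" using W1[of v] v by (auto simp: W'_def)
  next
    fix z assume "z \<in> W' \<inter> rights G"
    thus "Pred G z \<inter> W' \<inter> lefts G \<noteq> {}" using disj unfolding W'_def F_def by blast
  qed
  have reach_par: "(u, par z) \<in> (arcs G)\<^sup>*"
    if "u \<in> lefts G" "z \<in> rights G" "(u, z) \<in> (arcs G)\<^sup>*" for u z
    using that Pred_par[of z] disj by (auto simp: Pred_def)
  \<comment> \<open>\<open>full\<close> provides only some internal ancestor in \<open>W\<close>.
    Its paths to \<open>z\<close> pass through \<open>par z\<close>, so closure under descendants
    gives the parent.\<close>
  have par_W: "par z \<in> W" if z: "z \<in> W \<inter> rights G" for z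
  proof -
    from W z have "Pred G z \<inter> W \<inter> lefts G \<noteq> {}" unfolding full_def by blast
    then obtain u where "u \<in> W" "u \<in> lefts G" "(u, z) \<in> (arcs G)\<^sup>*"
      by (auto simp: Pred_def)
    thus ?thesis using reach_par[of u z] full_Succ[OF W, of u] z by (auto simp: Succ_def)
  qed
  have par_Pred: "par y \<in> Pred G y"
    using Pred_par[of y] y by (auto simp: Pred_def)
  \<comment> \<open>The parent of a forced leaf lay in \<open>W\<close> but is gone from
    \<open>W1\<close>, hence it is an ancestor of \<open>y\<close>. So is \<open>par y\<close>, and
    both have height 0.\<close>
  have F_sib: "par f = par y" if f: "f \<in> F" for f
  proof -
    have fW: "f \<in> W \<inter> rights G" using f by (auto simp: F_def W1_def)
    have "par f \<in> Pred G f" using Pred_par[of f] fW by (auto simp: Pred_def)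
    hence "par f \<in> Pred G y" using f par_W[OF fW] par[of f] fW by (auto simp: F_def W1_def)
    moreover have "par f \<in> lefts G" "par y \<in> lefts G" "h (par f) = h (par y)"
      using par[of f] par[of y] fW y by auto
    ultimately show ?thesis
      using inj_onD[OF inj_on_height_Pred[OF order_refl, of y], of "par f" "par y"] par_Pred by blast
  qed
  define C where "C = Pred G y \<inter> W \<inter> lefts G"
  have injC: "inj_on h C" by (rule inj_on_height_Pred[of _ y]) (auto simp: C_def)
  have finV: "finite W" using finite_subset[OF full_subset[OF W] finite_verts] .
  have "card C = card (h ` C)" by (simp add: card_image injC)
  also have "\<dots> \<le> card {..n}"
    by (rule card_mono) (use height_le in \<open>auto simp: C_def\<close>)
  finally have cardC: "card C \<le> n + 1" by simp
  have lefts_Pred: "Pred G y \<subseteq> insert y (lefts G)"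
  proof
    fix z assume "z \<in> Pred G y"
    thus "z \<in> insert y (lefts G)"
      using reach_in_verts[OF pos, of z y] leaf_reach[of z y] y by (auto simp: Pred_def verts_def)
  qed
  \<comment> \<open>The leaf \<open>y\<close> is counted among the at most \<open>c\<close> children
    of \<open>par y\<close>, so the loss is \<open>n + 1 + c\<close> with no further term for
    \<open>y\<close>.\<close>
  have sub: "W - W' \<subseteq> C \<union> {z \<in> rights G. par z = par y}"
    using lefts_Pred F_sib y by (auto simp: W'_def W1_def C_def F_def)
  have "card (W - W') \<le> card (C \<union> {z \<in> rights G. par z = par y})"
    using finV finite_verts sub by (intro card_mono) (auto simp: C_def verts_def)
  also have "\<dots> \<le> card C + card {z \<in> rights G. par z = par y}" by (rule card_Un_le)
  also have "\<dots> \<le> n + 1 + c" using cardC card_siblings[of "par y"] by simp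
  finally have card_diff: "card (W - W') \<le> n + 1 + c" .
  have psub: "W' \<subset> W" using y by (auto simp: W'_def W1_def Pred_def)
  have "card W = card W' + card (W - W')"
    using card_Diff_subset[of W' W] card_mono[of W W'] finite_subset[of W' W] finV psub by auto
  with card_diff have card: "card W \<le> card W' + (n + 1 + c)" by simp
  have "pot W = pot W' + (\<Sum>v\<in>C. wt (h v))"
  proof -
    have "W \<inter> lefts G = (W' \<inter> lefts G) \<union> C" "(W' \<inter> lefts G) \<inter> C = {}"
      using disj by (auto simp: W'_def W1_def C_def F_def)
    moreover have "finite (W' \<inter> lefts G)" "finite C"
      using finV by (auto simp: W'_def W1_def C_def)
    ultimately show ?thesis unfolding pot_def by (simp add: sum.union_disjoint)
  qed
  also have "(\<Sum>v\<in>C. wt (h v)) = sum wt (h ` C)" by (simp add: sum.reindex[OF injC])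
  finally have "pot W = pot W' + sum wt (h ` C)" .
  moreover have "2 - 2 ^ l \<le> sum wt (h ` C)"
  proof (rule sum_wt_ge)
    show "h ` C \<subseteq> {..l}" using le by (auto simp: C_def)
    have "par y \<in> C" "h (par y) = 0" using par[of y] par_W[of y] par_Pred y by (auto simp: C_def)
    thus "0 \<in> h ` C" by force
  qed
  ultimately have pot: "pot W' + 2 \<le> pot W + 2 ^ l" by simp
  have "W - ((Pred G y \<inter> W) \<union> F) = W'" by (auto simp: W'_def W1_def)
  hence "after (induced W) y = induced W'" by (simp add: after_def R induced_simps)
  from that[OF this fullW' psub card pot] show ?thesis .
qed

section \<open>The score bound by induction over rounds\<close>

text \<open>Here \<open>l\<close> plays the height of the component Left has just removed. The
  quantity \<open>pot W + 2 ^ l\<close> drops by at least 2 per round: Right's move leads to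
  \<open>pot W' + 2 \<le> pot W + 2 ^ l\<close>, and Left's reply at \<open>x\<close> turns
  \<open>pot W'\<close> into \<open>pot (W' - Succ G x) + 2 ^ h x\<close>. Half of it bounds the
  number of Right's moves, each costing at most \<open>n + 1 + c\<close>; doubling both sides avoids
  the division.\<close>

lemma card_le_sL2:
  assumes "full W" "\<And>v. v \<in> W \<inter> lefts G \<Longrightarrow> h v \<le> l"
  shows "2 * int (card W) \<le> 2 * int (sL2 (induced W)) + int (n + 1 + c) * (pot W + 2 ^ l)"
  using assms
proof (induction "card W" arbitrary: W l rule: less_induct)
  case less
  let ?K = "int (n + 1 + c)"
  note W = less.prems(1)
  have sub: "W \<subseteq> verts G" by (rule full_subset[OF W])
  have fin: "finite W" by (rule finite_subset[OF sub finite_verts])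
  have vW: "verts (induced W) = W" using sub by (auto simp: induced_simps)
  show ?case
  proof (cases "W = {}")
    case True
    thus ?thesis by (simp add: pot_def)
  next
    case False
    let ?S = "(\<lambda>y. sL1 (after (induced W) y)) ` (rights G \<inter> W)"
    have "sL2 (induced W) = Min ?S"
      using False fin vW by (subst sL2.simps) (simp add: induced_simps(2))
    moreover have "Min ?S \<in> ?S"
      using full_nonempty(2)[OF W False] fin by (intro Min_in) auto
    ultimately obtain y where y: "y \<in> W \<inter> rights G" "sL2 (induced W) = sL1 (after (induced W) y)"
      by auto
    from after_right[OF W y(1) less.prems(2)] obtain W' where
      W': "after (induced W) y = induced W'" "full W'" "W' \<subset> W"
        "card W \<le> card W' + (n + 1 + c)" "pot W' + 2 \<le> pot W + 2 ^ l" by metis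
    have sub': "W' \<subseteq> verts G" by (rule full_subset[OF W'(2)])
    have fin': "finite W'" by (rule finite_subset[OF sub' finite_verts])
    have vW': "verts (induced W') = W'" using sub' by (auto simp: induced_simps)
    have main: "2 * int (card W') \<le> 2 * int (sL1 (induced W')) + ?K * pot W'"
    proof (cases "W' = {}")
      case True
      thus ?thesis by (simp add: pot_def)
    next
      case False
      have ne: "h ` (W' \<inter> lefts G) \<noteq> {}" and finh: "finite (h ` (W' \<inter> lefts G))"
        using full_nonempty(1)[OF W'(2) False] fin' by auto
      \<comment> \<open>Left's strategy: the root of a highest remaining component. As Left
        maximises, the value of this one move bounds \<open>sL1\<close> from below.\<close>
      from Max_in[OF finh ne] obtain x where
        x: "x \<in> W' \<inter> lefts G" "h x = Max (h ` (W' \<inter> lefts G))" by auto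
      have top: "h v \<le> h x" if "v \<in> W' \<inter> lefts G" for v
        unfolding x(2) using that by (intro Max_ge[OF finh]) auto
      have L: "full (W' - Succ G x)" "Rmv (induced W') x = Succ G x"
        "after (induced W') x = induced (W' - Succ G x)"
        using Rmv_left[OF W'(2) x(1)] top by blast+
      have SW: "Succ G x \<subseteq> W'" using full_Succ[OF W'(2)] x(1) by blast
      have "sL1 (induced W') =
          Max ((\<lambda>x. card (Rmv (induced W') x) + sL2 (after (induced W') x)) ` (lefts G \<inter> W'))"
        using False fin' vW' by (subst sL1.simps) (simp add: induced_simps(1))
      also have "\<dots> \<ge> card (Rmv (induced W') x) + sL2 (after (induced W') x)"
        using x(1) fin' by (intro Max_ge) auto
      finally have sL1: "sL1 (induced W') \<ge> card (Succ G x) + sL2 (induced (W' - Succ G x))"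
        by (simp add: L(2,3))
      have cd: "card W' = card (Succ G x) + card (W' - Succ G x)"
        using card_Diff_subset[OF finite_subset[OF SW fin'] SW] card_mono[OF fin' SW] by simp
      have "card W' < card W" using psubset_card_mono[OF fin W'(3)] .
      hence "card (W' - Succ G x) < card W" using cd by simp
      \<comment> \<open>The height of the component just taken becomes the new \<open>l\<close>;
        maximality of \<open>h x\<close> makes it a bound for all remaining heights.\<close>
      from less.hyps[OF this L(1), of "h x"] top
      have IH: "2 * int (card (W' - Succ G x)) \<le> 2 * int (sL2 (induced (W' - Succ G x)))
          + ?K * (pot (W' - Succ G x) + 2 ^ h x)" by auto
      have "pot W' = pot (W' - Succ G x) + (\<Sum>v\<in>Succ G x \<inter> lefts G. wt (h v))"
      proof -
        have "(W' - Succ G x) \<inter> lefts G = W' \<inter> lefts G - Succ G x \<inter> lefts G" by auto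
        thus ?thesis
          unfolding pot_def using sum.subset_diff[of "Succ G x \<inter> lefts G" "W' \<inter> lefts G"] SW fin'
          by auto
      qed
      hence "pot W' = pot (W' - Succ G x) + 2 ^ h x" using subtree[of x] x(1) by simp
      thus ?thesis using IH sL1 cd by simp
    qed
    \<comment> \<open>Naming the products turns them into atoms, so the remaining combination is
      linear.\<close>
    define P Q K where "P = ?K * pot W'" and "Q = ?K * (pot W + 2 ^ l)" and "K = ?K"
    have "?K * (pot W' + 2) \<le> ?K * (pot W + 2 ^ l)"
      using W'(5) by (intro mult_left_mono) auto
    hence "?K * pot W' + 2 * ?K \<le> ?K * (pot W + 2 ^ l)" by (simp only: distrib_left mult.commute)
    moreover have "int (card W) \<le> int (card W') + ?K" using W'(4) by linarith
    ultimately show ?thesis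
      using main unfolding y(2) W'(1) P_def[symmetric] Q_def[symmetric] K_def[symmetric] by linarith
  qed
qed

text \<open>The induction starts with \<open>l = n\<close>, as if Left had just removed a component
  of height \<open>n\<close>; this is the extra \<open>2 ^ n\<close>.\<close>

theorem sL2_lower_bound:
  "2 * int (card (verts G)) \<le>
     2 * int (sL2 G) + int (n + 1 + c) * ((\<Sum>v\<in>lefts G. wt (h v)) + 2 ^ n)"
proof -
  have eq: "induced (verts G) = G"
    unfolding induced_def using pos by (cases G) (auto simp: delete_def is_position_def verts_def)
  have "full (verts G)"
    unfolding full_def
  proof (intro conjI ballI)
    fix x assume "x \<in> verts G"
    thus "Succ G x \<subseteq> verts G" using reach_in_verts[OF pos, of x] by (auto simp: Succ_def)
  next
    fix y assume "y \<in> verts G \<inter> rights G"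
    hence "par y \<in> Pred G y \<inter> verts G \<inter> lefts G"
      using par[of y] Pred_par[of y] by (auto simp: Pred_def verts_def)
    thus "Pred G y \<inter> verts G \<inter> lefts G \<noteq> {}" by blast
  qed simp
  moreover have "verts G \<inter> lefts G = lefts G" by (auto simp: verts_def)
  ultimately show ?thesis
    using card_le_sL2[of "verts G" n] height_le by (simp add: eq pot_def)
qed

end

section \<open>The trees and their disjoint union as ternary forests\<close>

text \<open>Descendants are extensions of the address. The case \<open>p = q\<close> stands apart
  because the reflexive closure also relates lists that are not vertices to themselves.\<close>

lemma tree_reach_iff:
  "(p, q) \<in> (arcs (tree c n))\<^sup>* \<longleftrightarrow> p = q \<or> q \<in> verts (tree c n) \<and> (\<exists>r. q = p @ r)"
proof
  assume "(p, q) \<in> (arcs (tree c n))\<^sup>*"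
  thus "p = q \<or> q \<in> verts (tree c n) \<and> (\<exists>r. q = p @ r)"
  proof induction
    case (step q q')
    then obtain i where "q' = q @ [i]" "q' \<in> verts (tree c n)"
      by (auto simp: tree_def verts_def)
    thus ?case using step.IH by auto
  qed simp
next
  have "(p, p @ r) \<in> (arcs (tree c n))\<^sup>*" if "p @ r \<in> verts (tree c n)" for r
    using that
  proof (induction r rule: rev_induct)
    case (snoc i r)
    hence "(p @ r) @ [i] \<in> verts (tree c n)" by simp
    hence "p @ r \<in> verts (tree c n)" "(p @ r, (p @ r) @ [i]) \<in> arcs (tree c n)"
      unfolding verts_def tree_def by (auto simp del: append_assoc)
    thus ?case using snoc.IH rtrancl_into_rtrancl[of p "p @ r" "arcs (tree c n)"] by simp
  qed simp
  thus "(p, q) \<in> (arcs (tree c n))\<^sup>*"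
    if "p = q \<or> q \<in> verts (tree c n) \<and> (\<exists>r. q = p @ r)"
    using that by auto
qed

text \<open>Truncated subtraction gives leaves, of length \<open>n + 1\<close>, height 0 as well;
  this is harmless because heights are only evaluated at internal vertices.\<close>

lemma ternary_forest_tree:
  assumes "c \<ge> 1"
  shows "ternary_forest (tree c n) (\<lambda>p. n - length p) butlast n c"
proof
  fix y assume "y \<in> rights (tree c n)"
  thus "Succ (tree c n) y = {y}" by (auto simp: Succ_def tree_reach_iff) (auto simp: tree_def verts_def)
next
  fix u v w assume "(u, w) \<in> (arcs (tree c n))\<^sup>*" "(v, w) \<in> (arcs (tree c n))\<^sup>*"
  thus "(u, v) \<in> (arcs (tree c n))\<^sup>* \<or> (v, u) \<in> (arcs (tree c n))\<^sup>*"
  proof (induction rule: rtrancl_induct)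
    case (step w w')
    show ?case
    proof (cases "v = w'")
      case True
      thus ?thesis using step.hyps by auto
    next
      case False
      \<comment> \<open>A vertex has only one incoming arc, so the path from \<open>v\<close> also
        arrives through \<open>w\<close> and the induction hypothesis applies.\<close>
      then obtain z where "(v, z) \<in> (arcs (tree c n))\<^sup>*" "(z, w') \<in> arcs (tree c n)"
        using step.prems by (meson rtranclE)
      moreover from this step.hyps have "z = w" by (auto simp: tree_def)
      ultimately show ?thesis using step.IH by blast
    qed
  qed auto
next
  fix y assume y: "y \<in> rights (tree c n)"
  thus "butlast y \<in> lefts (tree c n) \<and> n - length (butlast y) = 0" by (auto simp: tree_def)
  from y have e: "(butlast y, y) \<in> arcs (tree c n)" by (auto simp: tree_def)
  moreover have "z = butlast y" if "(z, y) \<in> arcs (tree c n)" for z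
    using that by (auto simp: tree_def)
  ultimately have "(z, y) \<in> (arcs (tree c n))\<^sup>* \<longleftrightarrow> z = y \<or> (z, butlast y) \<in> (arcs (tree c n))\<^sup>*" for z
    by (metis rtrancl.rtrancl_refl rtranclE rtrancl_into_rtrancl)
  thus "Pred (tree c n) y = insert y (Pred (tree c n) (butlast y))"
    by (auto simp: Pred_def)
next
  fix q
  have "{y \<in> rights (tree c n). butlast y = q} \<subseteq> (\<lambda>i. q @ [i]) ` {..<c}"
    by (auto simp: tree_def)
  thus "card {y \<in> rights (tree c n). butlast y = q} \<le> c"
    using surj_card_le[of "{..<c}"] by fastforce
next
  fix x assume x: "x \<in> lefts (tree c n)"
  let ?A = "{q. set q \<subseteq> {..<3::nat} \<and> length q \<le> n - length x}"
  have "Succ (tree c n) x \<inter> lefts (tree c n) = (@) x ` ?A"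
    using x by (auto simp: Succ_def tree_reach_iff) (auto simp: tree_def verts_def)
  hence "(\<Sum>v\<in>Succ (tree c n) x \<inter> lefts (tree c n). wt (n - length v))
      = (\<Sum>q\<in>?A. wt (n - length x - length q))"
    by (simp add: sum.reindex inj_on_def)
  thus "(\<Sum>v\<in>Succ (tree c n) x \<inter> lefts (tree c n). wt (n - length v)) = 2 ^ (n - length x)"
    by (simp only: sum_wt_ternary_lists)
next
  fix u v
  assume uv: "u \<in> lefts (tree c n)" "v \<in> lefts (tree c n)" "(u, v) \<in> (arcs (tree c n))\<^sup>*" "u \<noteq> v"
  then obtain r where "v = u @ r" "r \<noteq> []" by (auto simp: tree_reach_iff)
  hence "length u < length v" by simp
  thus "n - length v < n - length u" using uv by (auto simp: tree_def)
qed (use assms is_position_tree relevant_tree in auto)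

lemma disjoint_union_reach:
  "(Inl p, v) \<in> (arcs (disjoint_union G H))\<^sup>* \<longleftrightarrow> (\<exists>q. v = Inl q \<and> (p, q) \<in> (arcs G)\<^sup>*)"
  "(Inr p', v) \<in> (arcs (disjoint_union G H))\<^sup>* \<longleftrightarrow> (\<exists>q. v = Inr q \<and> (p', q) \<in> (arcs H)\<^sup>*)"
proof -
  let ?R = "arcs (disjoint_union G H)"
  have iff: "(Inl a, w) \<in> ?R \<longleftrightarrow> (\<exists>b. w = Inl b \<and> (a, b) \<in> arcs G)"
    "(Inr a', w) \<in> ?R \<longleftrightarrow> (\<exists>b. w = Inr b \<and> (a', b) \<in> arcs H)" for a a' w
    by (force simp: disjoint_union_def)+
  have "\<exists>q. v = Inl q \<and> (p, q) \<in> (arcs G)\<^sup>*" if "(Inl p, v) \<in> ?R\<^sup>*"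
    using that by induction (auto simp: iff intro: rtrancl_into_rtrancl)
  moreover have "(Inl p, Inl q) \<in> ?R\<^sup>*" if "(p, q) \<in> (arcs G)\<^sup>*" for q
    using that by induction (auto simp: iff intro: rtrancl_into_rtrancl)
  ultimately show "(Inl p, v) \<in> ?R\<^sup>* \<longleftrightarrow> (\<exists>q. v = Inl q \<and> (p, q) \<in> (arcs G)\<^sup>*)" by auto
  have "\<exists>q. v = Inr q \<and> (p', q) \<in> (arcs H)\<^sup>*" if "(Inr p', v) \<in> ?R\<^sup>*"
    using that by induction (auto simp: iff intro: rtrancl_into_rtrancl)
  moreover have "(Inr p', Inr q) \<in> ?R\<^sup>*" if "(p', q) \<in> (arcs H)\<^sup>*" for q
    using that by induction (auto simp: iff intro: rtrancl_into_rtrancl)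
  ultimately show "(Inr p', v) \<in> ?R\<^sup>* \<longleftrightarrow> (\<exists>q. v = Inr q \<and> (p', q) \<in> (arcs H)\<^sup>*)" by auto
qed

lemma disjoint_union_simps:
  "lefts (disjoint_union G H) = lefts G <+> lefts H"
  "rights (disjoint_union G H) = rights G <+> rights H"
  "verts (disjoint_union G H) = verts G <+> verts H"
  "Succ (disjoint_union G H) (Inl x) = Inl ` Succ G x"
  "Succ (disjoint_union G H) (Inr x') = Inr ` Succ H x'"
  "Pred (disjoint_union G H) (Inl x) = Inl ` Pred G x"
  "Pred (disjoint_union G H) (Inr x') = Inr ` Pred H x'"
proof -
  show "Pred (disjoint_union G H) (Inl x) = Inl ` Pred G x"
  proof (intro set_eqI)
    fix v show "v \<in> Pred (disjoint_union G H) (Inl x) \<longleftrightarrow> v \<in> Inl ` Pred G x"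
      by (cases v) (auto simp: Pred_def disjoint_union_reach)
  qed
  show "Pred (disjoint_union G H) (Inr x') = Inr ` Pred H x'"
  proof (intro set_eqI)
    fix v show "v \<in> Pred (disjoint_union G H) (Inr x') \<longleftrightarrow> v \<in> Inr ` Pred H x'"
      by (cases v) (auto simp: Pred_def disjoint_union_reach)
  qed
  show "Succ (disjoint_union G H) (Inl x) = Inl ` Succ G x"
    "Succ (disjoint_union G H) (Inr x') = Inr ` Succ H x'"
    by (auto simp: Succ_def disjoint_union_reach)
qed (auto simp: disjoint_union_def verts_def)

text \<open>No path joins the two parts, so each axiom reduces to one of them.\<close>

lemma ternary_forest_disjoint_union:
  assumes "ternary_forest G g p n c" "ternary_forest H h q n c"
    and pos: "is_position (disjoint_union G H)" and rel: "relevant (disjoint_union G H)"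
  shows "ternary_forest (disjoint_union G H) (case_sum g h) (map_sum p q) n c"
proof -
  interpret G: ternary_forest G g p n c by fact
  interpret H: ternary_forest H h q n c by fact
  let ?D = "disjoint_union G H"
  show ?thesis
  proof
    fix y assume y: "y \<in> rights ?D"
    thus "Succ ?D y = {y}" by (auto simp: disjoint_union_simps G.leaf H.leaf)
    show "map_sum p q y \<in> lefts ?D \<and> case_sum g h (map_sum p q y) = 0"
      using y by (auto simp: disjoint_union_simps G.par H.par)
    show "Pred ?D y = insert y (Pred ?D (map_sum p q y))"
      using y by (auto simp: disjoint_union_simps G.Pred_par H.Pred_par)
  next
    fix u v w assume "(u, w) \<in> (arcs ?D)\<^sup>*" "(v, w) \<in> (arcs ?D)\<^sup>*"
    thus "(u, v) \<in> (arcs ?D)\<^sup>* \<or> (v, u) \<in> (arcs ?D)\<^sup>*"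
      by (cases u rule: sum.exhaust; cases v rule: sum.exhaust) (auto simp: disjoint_union_reach dest: G.chain H.chain)
  next
    fix u v assume "u \<in> lefts ?D" "v \<in> lefts ?D" "(u, v) \<in> (arcs ?D)\<^sup>*" "u \<noteq> v"
    thus "case_sum g h v < case_sum g h u"
      by (cases u rule: sum.exhaust) (auto simp: disjoint_union_reach disjoint_union_simps
            intro: G.height_less H.height_less)
  next
    fix u assume "u \<in> lefts ?D"
    thus "case_sum g h u \<le> n"
      by (auto simp: disjoint_union_simps G.height_le H.height_le)
  next
    fix z
    show "card {y \<in> rights ?D. map_sum p q y = z} \<le> c"
    proof (cases z)
      case (Inl a)
      hence "{y \<in> rights ?D. map_sum p q y = z} = Inl ` {y \<in> rights G. p y = a}"
        by (auto simp: disjoint_union_simps)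
      thus ?thesis by (simp add: card_image G.card_siblings)
    next
      case (Inr a)
      hence "{y \<in> rights ?D. map_sum p q y = z} = Inr ` {y \<in> rights H. q y = a}"
        by (auto simp: disjoint_union_simps)
      thus ?thesis by (simp add: card_image H.card_siblings)
    qed
  next
    fix x assume x: "x \<in> lefts ?D"
    show "(\<Sum>v\<in>Succ ?D x \<inter> lefts ?D. wt (case_sum g h v)) = 2 ^ case_sum g h x"
    proof (cases x)
      case (Inl a)
      hence "Succ ?D x \<inter> lefts ?D = Inl ` (Succ G a \<inter> lefts G)"
        by (auto simp: disjoint_union_simps)
      thus ?thesis using Inl x G.subtree[of a] by (auto simp: sum.reindex disjoint_union_simps)
    next
      case (Inr a)
      hence "Succ ?D x \<inter> lefts ?D = Inr ` (Succ H a \<inter> lefts H)"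
        by (auto simp: disjoint_union_simps)
      thus ?thesis using Inr x H.subtree[of a] by (auto simp: sum.reindex disjoint_union_simps)
    qed
  qed (use pos rel in auto)
qed

section \<open>Vertex counts and asymptotics\<close>

lemma lefts_tree: "lefts (tree c n) = {p. set p \<subseteq> {..<3} \<and> length p \<le> n}"
  by (auto simp: tree_def)

lemma card_rights_tree: "card (rights (tree c n)) = c * 3 ^ n"
proof -
  let ?A = "{p. set p \<subseteq> {..<3::nat} \<and> length p = n}"
  have "rights (tree c n) = (\<lambda>(p, i). p @ [i]) ` (?A \<times> {..<c})"
    by (auto simp: tree_def image_iff)
  moreover have "inj_on (\<lambda>(p, i). p @ [i]) (?A \<times> {..<c})" by (auto simp: inj_on_def)
  ultimately show ?thesis
    by (simp add: card_image card_cartesian_product card_lists_length_eq)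
qed

lemma card_lefts_tree: "2 * card (lefts (tree c n)) \<le> 3 * 3 ^ n"
proof -
  have "2 * (\<Sum>i\<le>n. 3 ^ i) \<le> 3 * (3::nat) ^ n" by (induction n) auto
  thus ?thesis by (simp add: lefts_tree card_lists_length_le)
qed

lemma card_lefts_J: "card (lefts (J c n)) \<le> 3 * 3 ^ n"
proof -
  have "finite (lefts (tree c n))"
    using is_position_tree[of c n] by (simp add: is_position_def verts_def)
  thus ?thesis using card_lefts_tree[of c n] by (simp add: J_def disjoint_union_simps card_Plus)
qed

lemma card_verts_J: "2 * (c * 3 ^ n) \<le> card (verts (J c n))"
proof -
  have fin: "finite (verts (tree c n))"
    using is_position_tree[of c n] by (simp add: is_position_def)
  hence "card (rights (tree c n)) \<le> card (verts (tree c n))"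
    by (intro card_mono) (auto simp: verts_def)
  thus ?thesis using fin by (simp add: J_def disjoint_union_simps card_Plus card_rights_tree)
qed

text \<open>The two copies have potential \<open>2 * 2 ^ n\<close>, and the starting value
  \<open>l = n\<close> contributes a third \<open>2 ^ n\<close>.\<close>

lemma sL2_J:
  assumes "c \<ge> 1"
  shows "2 * int (card (verts (J c n))) \<le> 2 * int (sL2 (J c n)) + int (n + 1 + c) * (3 * 2 ^ n)"
proof -
  let ?h = "\<lambda>p :: nat list. n - length p"
  interpret ternary_forest "J c n" "case_sum ?h ?h" "map_sum butlast butlast" n c
    using ternary_forest_disjoint_union[OF ternary_forest_tree ternary_forest_tree, of c n]
      is_position_J[of c n] relevant_J[OF assms, of n] assms by (simp add: J_def)
  have "finite (lefts (tree c n))"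
    using is_position_tree[of c n] by (simp add: is_position_def verts_def)
  hence "(\<Sum>v\<in>lefts (J c n). wt (case_sum ?h ?h v)) = 2 * (\<Sum>p\<in>lefts (tree c n). wt (?h p))"
    by (simp add: J_def disjoint_union_simps sum.Plus)
  also have "\<dots> = 2 * 2 ^ n" by (simp add: lefts_tree sum_wt_ternary_lists)
  finally show ?thesis using sL2_lower_bound by simp
qed

theorem theorem28:
  fixes \<epsilon> :: real
  assumes "\<epsilon> > 0"
  shows "\<exists>n0 c0. \<forall>n\<ge>n0. \<forall>c\<ge>c0.
           real (card (lefts (J c n))) / real (card (verts (J c n))) \<le> \<epsilon> \<and>
           real (sL2 (J c n)) / real (card (verts (J c n))) \<ge> 1 - \<epsilon>"
proof -
  \<comment> \<open>The loss is at most \<open>(n + 1 + c) * (3 / 2) * 2 ^ n\<close> out of at least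
    \<open>2 * c * 3 ^ n\<close> vertices. Since \<open>n + 1 + c \<le> c * (n + 2)\<close>, the
    factor \<open>c\<close> cancels, so \<open>n0\<close> can be chosen independently of
    \<open>c\<close>.\<close>
  have "(\<lambda>n. (real n + 2) * (2 / 3) ^ n) \<longlonglongrightarrow> 0" by real_asymp
  hence "eventually (\<lambda>n. (real n + 2) * (2 / 3) ^ n < \<epsilon>) sequentially"
    using assms by (rule order_tendstoD)
  then obtain n0 where n0: "(real n + 2) * (2 / 3) ^ n < \<epsilon>" if "n \<ge> n0" for n
    by (auto simp: eventually_sequentially)
  \<comment> \<open>The internal vertices number at most \<open>3 * 3 ^ n\<close>, a fraction
    \<open>3 / (2 * c)\<close> of the lower bound for all vertices.\<close>
  obtain c0 where c0: "real c0 > 3 / (2 * \<epsilon>)" using reals_Archimedean2 by blast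
  show ?thesis
  proof (rule exI[of _ n0], rule exI[of _ "max 1 c0"], intro allI impI)
    fix n c assume n: "n \<ge> n0" and c: "c \<ge> max 1 c0"
    let ?V = "real (card (verts (J c n)))"
    have "real (2 * (c * 3 ^ n)) \<le> ?V" using card_verts_J[of c n] of_nat_le_iff by blast
    hence V: "2 * real c * 3 ^ n \<le> ?V" by simp
    have pos: "0 < 2 * real c * 3 ^ n" using c by simp
    hence V0: "?V > 0" using V by linarith
    have "real (card (lefts (J c n))) \<le> real (3 * 3 ^ n)"
      using card_lefts_J[of c n] of_nat_le_iff by blast
    also have "\<dots> = 3 * 3 ^ n" by simp
    also have "\<dots> \<le> \<epsilon> * (2 * real c * 3 ^ n)"
    proof -
      have "3 / (2 * \<epsilon>) \<le> real c" using c0 c by (auto simp: max_def split: if_splits)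
      hence "3 \<le> \<epsilon> * (2 * real c)" using assms by (simp add: field_simps)
      hence "3 * 3 ^ n \<le> (\<epsilon> * (2 * real c)) * 3 ^ n" by (rule mult_right_mono) simp
      thus ?thesis by (simp add: mult.assoc)
    qed
    also have "\<dots> \<le> \<epsilon> * ?V" using V assms by simp
    finally have 1: "real (card (lefts (J c n))) / ?V \<le> \<epsilon>"
      using V0 by (simp add: pos_divide_le_eq)
    have "real_of_int (2 * int (card (verts (J c n))))
        \<le> real_of_int (2 * int (sL2 (J c n)) + int (n + 1 + c) * (3 * 2 ^ n))"
      using sL2_J[of c n] c by (simp only: of_int_le_iff)
    hence s: "?V - real (sL2 (J c n)) \<le> (real n + 1 + real c) * (3 / 2 * 2 ^ n)"
      by (simp add: algebra_simps)
    also have "\<dots> \<le> (real c * (real n + 2)) * (3 / 2 * 2 ^ n)"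
    proof (rule mult_right_mono)
      \<comment> \<open>The difference of the two sides is \<open>(c - 1) * (n + 1)\<close>.\<close>
      have "1 * (real n + 1) \<le> real c * (real n + 1)" using c by (intro mult_right_mono) auto
      thus "real n + 1 + real c \<le> real c * (real n + 2)" by (simp add: algebra_simps)
    qed simp
    also have "\<dots> = 3 / 2 * (real c * 3 ^ n) * ((real n + 2) * (2 / 3) ^ n)"
      by (simp add: power_divide)
    \<comment> \<open>The constant 3/2 is relaxed to 2 to match the lower bound
      \<open>V\<close>.\<close>
    also have "\<dots> \<le> 2 * (real c * 3 ^ n) * \<epsilon>"
      using n0[OF n] pos by (intro mult_mono) auto
    also have "\<dots> \<le> ?V * \<epsilon>" using V assms by simp
    finally have "(1 - \<epsilon>) * ?V \<le> real (sL2 (J c n))" by (simp add: algebra_simps)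
    hence "1 - \<epsilon> \<le> real (sL2 (J c n)) / ?V" using V0 by (simp add: pos_le_divide_eq)
    with 1 show "real (card (lefts (J c n))) / ?V \<le> \<epsilon> \<and> real (sL2 (J c n)) / ?V \<ge> 1 - \<epsilon>"
      by simp
  qed
qed

end
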